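(* Let $\mathcal{H}$ be a complex separable Hilbert space and let $\mathcal{M},\mathcal{N}$ be linear subspaces of $\mathcal{H}$ such that $\mathcal{M}\cap\mathcal{N}$ is closed. Then the following are equivalent: (i) $P_{\mathcal{M},\mathcal{N}}$ is continuous; (ii) $P_{\mathcal{M},\mathcal{N}}$ is decomposable with bounded operator part $(P_{\mathcal{M},\mathcal{N}})_0$; (iii) $\overline{\mathcal{M}}\cap\overline{\mathcal{N}}=\mathcal{M}\cap\mathcal{N}$ and $\mathcal{M}^{\perp}+\mathcal{N}^{\perp}$ is closed.
   Context: A linear relation on $\mathcal{H}$ is a linear subspace $T$ of $\mathcal{H}\times\mathcal{H}$; operators are identified with their graphs. $\operatorname{dom}T$ is the set of first components, $\operatorname{mul}T=\{y:(0,y)\in T\}$. The adjoint is $T^*=\{(x,y):\langle g,x\rangle=\langle f,y\rangle\ \forall(f,g)\in T\}$. For a relation $T$, $T_0:=T\cap(\overline{\operatorname{dom}}\,T\times\overline{\operatorname{dom}}\,T^* )$ (an operator), and $T$ is decomposable if $\operatorname{dom}T_0=\operatorname{dom}T$, in which case $T_0$ is its operator part. $T$ is continuous if for every neighbourhood $V$ in $\operatorname{ran}T$, $T^{-1}(V)$ is a neighbourhood in $\operatorname{dom}T$; equivalently, the operator $T_m:=QT=\{(x,Qy):(x,y)\in T\}$, with $Q$ the orthogonal projection onto $(\operatorname{mul}T)^{\perp}$, is bounded on $\operatorname{dom}T$. For subspaces $\mathcal{M},\mathcal{N}$, $P_{\mathcal{M},\mathcal{N}}=\{(m+n,m):m\in\mathcal{M},n\in\mathcal{N}\}$,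 with domain $\mathcal{M}+\mathcal{N}$ and multivalued part $\mathcal{M}\cap\mathcal{N}$. *)

theory Defs
  imports "HOL-Analysis.Analysis"
begin

section \<open>Complex Hilbert spaces\<close>

class scaleC =
  fixes scaleC :: "complex \<Rightarrow> 'a \<Rightarrow> 'a"  (infixr \<open>*\<^sub>C\<close> 75)

text \<open>
  The inner product is linear in its first argument. Positive definiteness is part of the last
  axiom, since the norm of a normed space is positive definite.
\<close>

class complex_inner = real_normed_vector + scaleC +
  fixes cinner :: "'a \<Rightarrow> 'a \<Rightarrow> complex"
  assumes scaleC_add_right: "a *\<^sub>C (x + y) = a *\<^sub>C x + a *\<^sub>C y"
    and scaleC_add_left: "(a + b) *\<^sub>C x = a *\<^sub>C x + b *\<^sub>C x"
    and scaleC_scaleC: "a *\<^sub>C (b *\<^sub>C x) = (a * b) *\<^sub>C x"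
    and scaleC_one: "1 *\<^sub>C x = x"
    and scaleR_scaleC: "r *\<^sub>R x = complex_of_real r *\<^sub>C x"
    and cinner_commute: "cinner x y = cnj (cinner y x)"
    and cinner_add_left: "cinner (x + y) z = cinner x z + cinner y z"
    and cinner_scaleC_left: "cinner (a *\<^sub>C x) y = a * cinner x y"
    and cinner_self: "cinner x x = complex_of_real ((norm x)\<^sup>2)"

class chilbert_space = complex_inner + complete_space

global_interpretation complex_vector: vector_space "scaleC :: complex \<Rightarrow> 'a \<Rightarrow> 'a::complex_inner"
  defines csubspace_raw_def: csubspace = complex_vector.subspace
  by unfold_locales
    (simp_all add: scaleC_add_right scaleC_add_left scaleC_scaleC scaleC_one)

hide_const (open) complex_vector.subspace

instantiation complex :: chilbert_space
begin

definition scaleC_complex :: "complex \<Rightarrow> complex \<Rightarrow> complex"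
  where "scaleC_complex a x = a * x"

definition cinner_complex :: "complex \<Rightarrow> complex \<Rightarrow> complex"
  where "cinner_complex x y = x * cnj y"

instance
proof
  fix x :: complex
  show "cinner x x = complex_of_real ((norm x)\<^sup>2)"
    unfolding cinner_complex_def by (rule complex_norm_square[symmetric])
qed (simp_all add: scaleC_complex_def cinner_complex_def algebra_simps scaleR_conv_of_real)

end

instantiation prod :: (complex_inner, complex_inner) complex_inner
begin

definition scaleC_prod :: "complex \<Rightarrow> 'a \<times> 'b \<Rightarrow> 'a \<times> 'b"
  where "scaleC_prod a p = (a *\<^sub>C fst p, a *\<^sub>C snd p)"

definition cinner_prod :: "'a \<times> 'b \<Rightarrow> 'a \<times> 'b \<Rightarrow> complex"
  where "cinner_prod p q = cinner (fst p) (fst q) + cinner (snd p) (snd q)"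

instance
proof
  fix p q r :: "'a \<times> 'b" and a b :: complex and c :: real
  show "a *\<^sub>C (p + q) = a *\<^sub>C p + a *\<^sub>C q"
    by (simp add: scaleC_prod_def scaleC_add_right)
  show "(a + b) *\<^sub>C p = a *\<^sub>C p + b *\<^sub>C p"
    by (simp add: scaleC_prod_def scaleC_add_left)
  show "a *\<^sub>C (b *\<^sub>C p) = (a * b) *\<^sub>C p"
    by (simp add: scaleC_prod_def scaleC_scaleC)
  show "1 *\<^sub>C p = p"
    by (simp add: scaleC_prod_def scaleC_one)
  show "c *\<^sub>R p = complex_of_real c *\<^sub>C p"
    by (simp add: scaleC_prod_def scaleR_prod_def scaleR_scaleC)
  show "cinner p q = cnj (cinner q p)"
    by (simp add: cinner_prod_def cinner_commute[symmetric])
  show "cinner (p + q) r = cinner p r + cinner q r"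
    by (simp add: cinner_prod_def cinner_add_left)
  show "cinner (a *\<^sub>C p) q = a * cinner p q"
    by (simp add: cinner_prod_def scaleC_prod_def cinner_scaleC_left algebra_simps)
  show "cinner p p = complex_of_real ((norm p)\<^sup>2)"
    by (simp add: cinner_prod_def cinner_self norm_prod_def)
qed

end

instance prod :: (chilbert_space, chilbert_space) chilbert_space ..

definition orth_compl :: "'a::complex_inner set \<Rightarrow> 'a set"
  where "orth_compl M = {x. \<forall>m\<in>M. cinner x m = 0}"


section \<open>Linear relations\<close>

text \<open>
  A relation is a set of pairs; its domain and range are the library's \<^const>\<open>Domain\<close> and
  \<^const>\<open>Range\<close>, and operators are identified with their graphs.
\<close>

abbreviation linear_relation :: "('a::complex_inner \<times> 'a) set \<Rightarrow> bool"
  where "linear_relation T \<equiv> csubspace T"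

definition mul :: "('a::complex_inner \<times> 'a) set \<Rightarrow> 'a set"
  where "mul T = {y. (0, y) \<in> T}"

definition rel_adjoint :: "('a::complex_inner \<times> 'a) set \<Rightarrow> ('a \<times> 'a) set"
  where "rel_adjoint T = {(x, y). \<forall>(f, g)\<in>T. cinner g x = cinner f y}"

definition op_part :: "('a::complex_inner \<times> 'a) set \<Rightarrow> ('a \<times> 'a) set"
  where "op_part T = T \<inter> (closure (Domain T) \<times> closure (Domain (rel_adjoint T)))"

definition decomposable :: "('a::complex_inner \<times> 'a) set \<Rightarrow> bool"
  where "decomposable T \<longleftrightarrow> Domain (op_part T) = Domain T"

definition bounded_operator :: "('a::complex_inner \<times> 'a) set \<Rightarrow> bool"
  where "bounded_operator T \<longleftrightarrow>
    single_valued T \<and> (\<exists>c. \<forall>(x, y)\<in>T. norm y \<le> c * norm x)"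

definition neighbourhood_in :: "'a topology \<Rightarrow> 'a \<Rightarrow> 'a set \<Rightarrow> bool"
  where "neighbourhood_in X x V \<longleftrightarrow>
    V \<subseteq> topspace X \<and> (\<exists>U. openin X U \<and> x \<in> U \<and> U \<subseteq> V)"

text \<open>
  Preimages of neighbourhoods are neighbourhoods, domain and range carrying the subspace
  topologies: if \<open>V\<close> is a neighbourhood of \<open>y\<close> in the range, then \<open>T\<inverse> `` V\<close> is a neighbourhood
  in the domain of every \<open>x\<close> that \<open>T\<close> relates to \<open>y\<close>.
\<close>

definition rel_continuous :: "('a::complex_inner \<times> 'a) set \<Rightarrow> bool"
  where "rel_continuous T \<longleftrightarrow>
    (\<forall>(x, y)\<in>T. \<forall>V. neighbourhood_in (top_of_set (Range T)) y V \<longrightarrow>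
      neighbourhood_in (top_of_set (Domain T)) x (T\<inverse> `` V))"

definition proj_rel :: "'a::complex_inner set \<Rightarrow> 'a set \<Rightarrow> ('a \<times> 'a) set"
  where "proj_rel M N = {(m + n, m) | m n. m \<in> M \<and> n \<in> N}"

lemma linear_relation_proj_rel:
  assumes "csubspace M" "csubspace N"
  shows "linear_relation (proj_rel M N)"
proof (rule complex_vector.subspaceI)
  show "0 \<in> proj_rel M N"
    using complex_vector.subspace_0[OF assms(1)] complex_vector.subspace_0[OF assms(2)]
    by (force simp: proj_rel_def zero_prod_def)
next
  fix p q assume "p \<in> proj_rel M N" "q \<in> proj_rel M N"
  then obtain m n m' n' where "p = (m + n, m)" "q = (m' + n', m')"
    and mem: "m \<in> M" "n \<in> N" "m' \<in> M" "n' \<in> N"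
    by (auto simp: proj_rel_def)
  then have "p + q = ((m + m') + (n + n'), m + m')"
    by (simp add: algebra_simps)
  moreover have "m + m' \<in> M" "n + n' \<in> N"
    using mem assms complex_vector.subspace_add by blast+
  ultimately show "p + q \<in> proj_rel M N"
    unfolding proj_rel_def by blast
next
  fix a and p assume "p \<in> proj_rel M N"
  then obtain m n where "p = (m + n, m)" and mem: "m \<in> M" "n \<in> N"
    by (auto simp: proj_rel_def)
  then have "a *\<^sub>C p = (a *\<^sub>C m + a *\<^sub>C n, a *\<^sub>C m)"
    by (simp add: scaleC_prod_def scaleC_add_right)
  moreover have "a *\<^sub>C m \<in> M" "a *\<^sub>C n \<in> N"
    using mem assms complex_vector.subspace_scale by blast+
  ultimately show "a *\<^sub>C p \<in> proj_rel M N"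
    unfolding proj_rel_def by blast
qed

lemma Domain_proj_rel: "Domain (proj_rel M N) = {m + n | m n. m \<in> M \<and> n \<in> N}"
  by (auto simp: proj_rel_def)

lemma mul_proj_rel:
  assumes "csubspace M" "csubspace N"
  shows "mul (proj_rel M N) = M \<inter> N"
proof
  show "mul (proj_rel M N) \<subseteq> M \<inter> N"
  proof
    fix y assume "y \<in> mul (proj_rel M N)"
    then obtain n where "y \<in> M" "n \<in> N" "y + n = 0"
      by (auto simp: mul_def proj_rel_def)
    then have "y = - n"
      by (simp add: eq_neg_iff_add_eq_0)
    with \<open>y \<in> M\<close> \<open>n \<in> N\<close> show "y \<in> M \<inter> N"
      using complex_vector.subspace_neg[OF assms(2)] by blast
  qed
  show "M \<inter> N \<subseteq> mul (proj_rel M N)"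
  proof
    fix y assume "y \<in> M \<inter> N"
    then have "y \<in> M" "- y \<in> N" "(0, y) = (y + - y, y)"
      using complex_vector.subspace_neg[OF assms(2)] by auto
    then show "y \<in> mul (proj_rel M N)"
      unfolding mul_def proj_rel_def by blast
  qed
qed

end

theory Submission
  imports Defs
begin

text \<open>
  For a linear relation \<open>T\<close> with closed multivalued part \<open>K\<close>, continuity means that every \<open>x\<close> in
  the domain has an image of norm at most \<open>c \<parallel>x\<parallel>\<close>. By Riesz representation and uniform
  boundedness this holds exactly when \<open>T\<^sup>*\<close> has domain \<open>K\<^sup>\<bottom>\<close>, and then the operator part consists
  of the pairs of \<open>T\<close> whose second entry is orthogonal to \<open>K\<close>. For \<open>P\<^bsub>M,N\<^esub>\<close> the domain of the adjoint is
  \<open>S = M\<^sup>\<bottom> + N\<^sup>\<bottom>\<close>, whose orthogonal complement is the intersection of the closures of \<open>M\<close> and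
  \<open>N\<close>; so \<open>S = (M \<inter> N)\<^sup>\<bottom>\<close> is condition (iii).
\<close>

section \<open>The complex inner product\<close>

instance chilbert_space \<subseteq> banach ..

lemma cinner_add_right: "cinner x (y + z) = cinner x y + cinner x z"
  by (metis cinner_add_left cinner_commute complex_cnj_add)

lemma cinner_eq_0_commute: "cinner x y = 0 \<longleftrightarrow> cinner y x = 0"
  by (metis cinner_commute complex_cnj_zero)

lemma cinner_scaleC_right: "cinner x (a *\<^sub>C y) = cnj a * cinner x y"
  by (metis cinner_commute cinner_scaleC_left complex_cnj_mult)

text \<open>The normed-space axioms give homogeneity for real scalars only; for complex ones it
  comes from \<open>cinner_self\<close> and the scalar rules of the inner product.\<close>

lemma norm_scaleC:
  fixes x :: "'a::complex_inner"
  shows "norm (a *\<^sub>C x) = cmod a * norm x"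
proof -
  have "complex_of_real ((norm (a *\<^sub>C x))\<^sup>2) = a * cnj a * complex_of_real ((norm x)\<^sup>2)"
    by (simp add: cinner_self[symmetric] cinner_scaleC_left cinner_scaleC_right
        del: of_real_power)
  then have "complex_of_real ((norm (a *\<^sub>C x))\<^sup>2) = complex_of_real ((cmod a * norm x)\<^sup>2)"
    by (simp add: complex_norm_square[symmetric] power_mult_distrib del: of_real_power)
  then show ?thesis
    by (simp only: of_real_eq_iff) (simp add: power2_eq_iff_nonneg)
qed

lemma norm_add_sq: "(norm (x + y))\<^sup>2 = (norm x)\<^sup>2 + (norm y)\<^sup>2 + 2 * Re (cinner x y)"
proof -
  have "complex_of_real ((norm (x + y))\<^sup>2)
      = complex_of_real ((norm x)\<^sup>2) + complex_of_real ((norm y)\<^sup>2) + (cinner x y + cnj (cinner x y))"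
    by (simp only: cinner_self[symmetric] cinner_add_left cinner_add_right
        cinner_commute[of y x] ac_simps)
  then have "Re (complex_of_real ((norm (x + y))\<^sup>2)) = Re \<dots>"
    by (rule arg_cong)
  then show ?thesis by simp
qed

text \<open>The Cauchy-Schwarz inequality: for nonzero \<open>y\<close>, evaluate the nonnegative
  quantity \<open>(norm (x + a *\<^sub>C y))\<^sup>2\<close> at the scalar \<open>a\<close> that
  minimizes it.\<close>

lemma norm_cinner_le: "cmod (cinner x y) \<le> norm x * norm y"
proof (cases "y = 0")
  case True
  have "cinner x (0 *\<^sub>C y) = 0" by (simp only: cinner_scaleC_right) simp
  then show ?thesis using True by simp
next
  case False
  define s where "s = cinner x y"
  define a where "a = - (s / complex_of_real ((norm y)\<^sup>2))"
  have p: "(norm y)\<^sup>2 > 0" using False by simp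
  have "cnj a * s = - complex_of_real ((cmod s)\<^sup>2 / (norm y)\<^sup>2)"
    unfolding a_def using complex_norm_square[of s] by (simp add: mult.commute)
  then have r: "Re (cnj a * s) = - ((cmod s)\<^sup>2 / (norm y)\<^sup>2)"
    by (simp only: uminus_complex.sel Re_complex_of_real)
  have n: "(cmod a * norm y)\<^sup>2 = (cmod s)\<^sup>2 / (norm y)\<^sup>2"
    using p by (simp add: a_def norm_divide norm_mult power2_eq_square)
  have "0 \<le> (norm (x + a *\<^sub>C y))\<^sup>2" by simp
  also have "\<dots> = (norm x)\<^sup>2 - (cmod s)\<^sup>2 / (norm y)\<^sup>2"
    by (simp only: norm_add_sq norm_scaleC cinner_scaleC_right s_def[symmetric] r n)
  finally have "(cmod s)\<^sup>2 \<le> (norm x * norm y)\<^sup>2"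
    using p by (simp add: field_simps power_mult_distrib)
  then show ?thesis unfolding s_def by (rule power2_le_imp_le) simp
qed

lemma bounded_bilinear_cinner: "bounded_bilinear cinner"
proof
  show "\<exists>K. \<forall>a b. cmod (cinner a b) \<le> norm a * norm b * K"
    using norm_cinner_le by (metis mult.right_neutral)
qed (simp_all add: cinner_add_left cinner_add_right scaleR_scaleC cinner_scaleC_left
    cinner_scaleC_right scaleC_complex_def)

lemmas cinner_simps = bounded_bilinear.diff_left[OF bounded_bilinear_cinner]
  bounded_bilinear.diff_right[OF bounded_bilinear_cinner]
  bounded_bilinear.zero_left[OF bounded_bilinear_cinner]
  bounded_bilinear.zero_right[OF bounded_bilinear_cinner]
  cinner_add_left cinner_add_right cinner_scaleC_left cinner_scaleC_right

lemmas tendsto_cinner = bounded_bilinear.tendsto[OF bounded_bilinear_cinner]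

lemma csubspace_scaleR: "csubspace W \<Longrightarrow> x \<in> W \<Longrightarrow> r *\<^sub>R x \<in> W"
  by (simp add: scaleR_scaleC complex_vector.subspace_scale)

section \<open>Riesz representation and orthogonal complements\<close>

text \<open>The representing vector is the limit of a minimizing sequence of
  \<open>\<parallel>w\<parallel>\<^sup>2 - 2 Re \<phi>(w)\<close>, which is Cauchy by the parallelogram law.\<close>

lemma riesz_representation:
  fixes W :: "'a::chilbert_space set" and \<phi> :: "'a \<Rightarrow> complex"
  assumes W: "csubspace W"
    and add: "\<And>x y. x \<in> W \<Longrightarrow> y \<in> W \<Longrightarrow> \<phi> (x + y) = \<phi> x + \<phi> y"
    and scale: "\<And>a x. x \<in> W \<Longrightarrow> \<phi> (a *\<^sub>C x) = a * \<phi> x"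
    and bound: "\<And>x. x \<in> W \<Longrightarrow> cmod (\<phi> x) \<le> c * norm x"
  obtains y where "y \<in> closure W" "\<And>x. x \<in> W \<Longrightarrow> \<phi> x = cinner x y"
proof -
  define F where "F w = (norm w)\<^sup>2 - 2 * Re (\<phi> w)" for w
  define i where "i = Inf (F ` W)"
  have scaleR: "\<phi> (r *\<^sub>R x) = of_real r * \<phi> x" if "x \<in> W" for r x
    using scale[OF that] by (simp add: scaleR_scaleC)
  \<comment> \<open>Completing the square: \<open>(norm w - c)\<^sup>2\<close> is nonnegative. This
    makes the infimum \<open>i\<close> meaningful.\<close>
  have lower: "F w \<ge> - c\<^sup>2" if "w \<in> W" for w
  proof -
    have "Re (\<phi> w) \<le> c * norm w"
      using bound[OF that] complex_Re_le_cmod[of "\<phi> w"] by linarith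
    moreover have "0 \<le> (norm w - c)\<^sup>2" by simp
    ultimately show ?thesis unfolding F_def by (simp add: power2_eq_square algebra_simps)
  qed
  have bdd: "bdd_below (F ` W)"
    using lower by (intro bdd_belowI[of _ "- c\<^sup>2"]) auto
  have ne: "F ` W \<noteq> {}" using complex_vector.subspace_0[OF W] by blast
  have i_le: "i \<le> F w" if "w \<in> W" for w
    unfolding i_def using that bdd by (intro cInf_lower) auto
  have "\<exists>w\<in>W. F w < i + inverse (real (Suc n))" for n
  proof -
    have "Inf (F ` W) < i + inverse (real (Suc n))" unfolding i_def by simp
    then show ?thesis using cInf_lessD[OF ne] by blast
  qed
  then obtain w where wW: "\<And>n. w n \<in> W" and wF: "\<And>n. F (w n) < i + inverse (real (Suc n))"
    by metis
  have "(\<lambda>n. i + inverse (real (Suc n))) \<longlonglongrightarrow> i + 0"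
    by (intro tendsto_intros LIMSEQ_inverse_real_of_nat)
  then have upper: "(\<lambda>n. i + inverse (real (Suc n))) \<longlonglongrightarrow> i" by simp
  have Flim: "(\<lambda>n. F (w n)) \<longlonglongrightarrow> i"
  proof (rule real_tendsto_sandwich[OF _ _ tendsto_const upper])
    show "\<forall>\<^sub>F n in sequentially. i \<le> F (w n)"
      by (rule always_eventually, rule allI, rule i_le, rule wW)
    show "\<forall>\<^sub>F n in sequentially. F (w n) \<le> i + inverse (real (Suc n))"
      by (rule always_eventually, rule allI, rule less_imp_le, rule wF)
  qed
  \<comment> \<open>The left side equals twice the values of \<open>F\<close> at \<open>w m\<close>
    and \<open>w n\<close> minus four times its value at their midpoint, and the midpoint value is
    at least \<open>i\<close>.\<close>
  have dist: "(norm (w m - w n))\<^sup>2 < 2 * inverse (real (Suc m)) + 2 * inverse (real (Suc n))" for m n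
  proof -
    have mid: "(1/2) *\<^sub>R (w m + w n) \<in> W"
      by (rule csubspace_scaleR[OF W complex_vector.subspace_add[OF W wW wW]])
    have "F ((1/2) *\<^sub>R (w m + w n)) = (norm (w m + w n))\<^sup>2 / 4 - (Re (\<phi> (w m)) + Re (\<phi> (w n)))"
      unfolding F_def scaleR[OF complex_vector.subspace_add[OF W wW wW]] add[OF wW wW]
      by (simp add: power_divide add_divide_distrib)
    moreover have "(norm (w m - w n))\<^sup>2 + (norm (w m + w n))\<^sup>2 = 2 * (norm (w m))\<^sup>2 + 2 * (norm (w n))\<^sup>2"
      using norm_add_sq[of "w m" "w n"] norm_add_sq[of "w m - w n" "w n"]
        norm_add_sq[of "w m" "- w n"]
        bounded_bilinear.minus_right[OF bounded_bilinear_cinner, of "w m" "w n"]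
      by simp
    ultimately show ?thesis
      using i_le[OF mid] wF[of m] wF[of n] unfolding F_def by argo
  qed
  have "Cauchy w"
  proof (rule CauchyI)
    fix e :: real assume "e > 0"
    then have "e\<^sup>2 / 4 > 0" by simp
    then obtain N where N: "inverse (real (Suc N)) < e\<^sup>2 / 4" using reals_Archimedean by blast
    have "norm (w m - w n) < e" if "m \<ge> N" "n \<ge> N" for m n
    proof (rule power2_less_imp_less)
      have "inverse (real (Suc m)) \<le> inverse (real (Suc N))"
        "inverse (real (Suc n)) \<le> inverse (real (Suc N))"
        using that by (auto intro!: le_imp_inverse_le)
      then show "(norm (w m - w n))\<^sup>2 < e\<^sup>2" using dist[of m n] N by argo
    qed (use \<open>e > 0\<close> in simp)
    then show "\<exists>M. \<forall>m\<ge>M. \<forall>n\<ge>M. norm (w m - w n) < e" by blast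
  qed
  then obtain y where y: "w \<longlonglongrightarrow> y"
    using Cauchy_convergent convergentD by blast
  have re: "Re (\<phi> x) = Re (cinner x y)" if x: "x \<in> W" for x
  proof -
    define d where "d = Re (cinner x y) - Re (\<phi> x)"
    define q where "q = (norm x)\<^sup>2"
    \<comment> \<open>Perturbing the minimizing sequence in direction \<open>x\<close> cannot push
      \<open>F\<close> below \<open>i\<close>. The limit is taken only after expanding, because
      \<open>y\<close> may lie outside \<open>W\<close>, where nothing is known about
      \<open>\<phi>\<close>.\<close>
    have quad: "0 \<le> 2 * t * d + t\<^sup>2 * q" for t
    proof -
      have low: "i \<le> F (w n) + (2 * t * (Re (cinner x (w n)) - Re (\<phi> x)) + t\<^sup>2 * q)" for n
      proof -
        have "i \<le> F (t *\<^sub>R x + w n)"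
          by (rule i_le[OF complex_vector.subspace_add[OF W csubspace_scaleR[OF W x] wW]])
        also have "\<dots> = F (w n) + (2 * t * (Re (cinner x (w n)) - Re (\<phi> x)) + t\<^sup>2 * q)"
          unfolding F_def norm_add_sq q_def
          by (simp add: add csubspace_scaleR W x wW scaleR power_mult_distrib algebra_simps
              bounded_bilinear.scaleR_left[OF bounded_bilinear_cinner])
        finally show ?thesis .
      qed
      have lim: "(\<lambda>n. F (w n) + (2 * t * (Re (cinner x (w n)) - Re (\<phi> x)) + t\<^sup>2 * q))
          \<longlonglongrightarrow> i + (2 * t * d + t\<^sup>2 * q)"
        unfolding d_def by (intro tendsto_intros Flim tendsto_cinner y)
      have "i \<le> i + (2 * t * d + t\<^sup>2 * q)"
        by (rule LIMSEQ_le_const[OF lim], rule exI, intro allI impI, rule low)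
      then show ?thesis by simp
    qed
    have q: "q \<ge> 0" by (simp add: q_def)
    \<comment> \<open>At \<open>t = - u\<close> the quadratic equals
      \<open>- (u\<^sup>2 * (q + 2))\<close>, which forces \<open>u = 0\<close> and hence
      \<open>d = 0\<close>. The added 1 keeps the denominator positive when
      \<open>x = 0\<close>.\<close>
    define u where "u = d / (q + 1)"
    have d: "d = u * (q + 1)" using q by (simp add: u_def)
    have "0 \<le> - (u\<^sup>2 * (q + 2))"
      using quad[of "- u"] unfolding d by (simp add: power2_eq_square algebra_simps)
    then have "u = 0" using q by (auto simp: mult_le_0_iff)
    then show ?thesis using d by (simp add: d_def)
  qed
  have "\<phi> x = cinner x y" if x: "x \<in> W" for x
  proof (rule complex_eqI)
    show "Re (\<phi> x) = Re (cinner x y)" by (rule re[OF x])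
    \<comment> \<open>By complex linearity, equality of real parts at
      \<open>\<i> *\<^sub>C x\<close> is equality of imaginary parts at \<open>x\<close>.\<close>
    show "Im (\<phi> x) = Im (cinner x y)"
      using re[OF complex_vector.subspace_scale[OF W x, of \<i>]]
      unfolding scale[OF x] cinner_scaleC_left by simp
  qed
  moreover have "y \<in> closure W"
    using closure_sequential[of y W] wW y by blast
  ultimately show thesis by (rule that[rotated])
qed

text \<open>The projection is the Riesz vector of the functional
  \<open>\<lambda>w. cinner w x\<close> on \<open>W\<close>. It is located in the closure because
  \<open>W\<close> itself need not be closed.\<close>

lemma orthogonal_projection_exists:
  fixes W :: "'a::chilbert_space set"
  assumes "csubspace W"
  obtains y where "y \<in> closure W" "x - y \<in> orth_compl W"
proof -
  obtain y where y: "y \<in> closure W" "\<And>w. w \<in> W \<Longrightarrow> cinner w x = cinner w y"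
  proof (rule riesz_representation[of W "\<lambda>w. cinner w x" "norm x"])
    show "cmod (cinner w x) \<le> norm x * norm w" for w
      using norm_cinner_le[of w x] by (simp add: mult.commute)
  qed (use assms in \<open>auto simp: cinner_simps\<close>)
  have "cinner (x - y) w = 0" if "w \<in> W" for w
    using y(2)[OF that] by (metis cinner_commute cinner_simps(1) right_minus_eq)
  then show thesis using that y(1) unfolding orth_compl_def by blast
qed

lemma csubspace_orth_compl: "csubspace (orth_compl M)"
  by (rule complex_vector.subspaceI) (auto simp: orth_compl_def cinner_simps)

lemma closed_orth_compl: "closed (orth_compl M)"
proof -
  have "orth_compl M = (\<Inter>m\<in>M. {x. cinner x m = 0})" by (auto simp: orth_compl_def)
  then show ?thesis
    by (auto intro!: closed_INT closed_Collect_eq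
        bounded_bilinear.continuous_on[OF bounded_bilinear_cinner] continuous_intros)
qed

lemma orth_complD: "x \<in> orth_compl M \<Longrightarrow> m \<in> M \<Longrightarrow> cinner x m = 0"
  "x \<in> orth_compl M \<Longrightarrow> m \<in> M \<Longrightarrow> cinner m x = 0"
  by (auto simp: orth_compl_def cinner_eq_0_commute[of m])

lemma subset_orth_compl_twice: "M \<subseteq> orth_compl (orth_compl M)"
  by (auto simp: orth_compl_def[of "orth_compl M"] orth_complD)

lemma orth_compl_Int: "x \<in> M \<Longrightarrow> x \<in> orth_compl M \<Longrightarrow> x = 0"
  using orth_complD(1)[of x M x] by (simp add: cinner_self)

text \<open>For \<open>x\<close> in the double complement, the residual of its projection onto the
  closure lies in both \<open>orth_compl M\<close> and its complement, so it vanishes.\<close>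

lemma orth_compl_orth_compl:
  fixes M :: "'a::chilbert_space set"
  assumes "csubspace M"
  shows "orth_compl (orth_compl M) = closure M"
proof
  show sub: "closure M \<subseteq> orth_compl (orth_compl M)"
    by (intro closure_minimal subset_orth_compl_twice closed_orth_compl)
  show "orth_compl (orth_compl M) \<subseteq> closure M"
  proof
    fix x assume x: "x \<in> orth_compl (orth_compl M)"
    obtain y where y: "y \<in> closure M" "x - y \<in> orth_compl M"
      using orthogonal_projection_exists[OF assms] by blast
    have "x - y \<in> orth_compl (orth_compl M)"
      using x y(1) sub by (intro complex_vector.subspace_diff csubspace_orth_compl) auto
    then have "x - y = 0" using y(2) orth_compl_Int by blast
    then show "x \<in> closure M" using y(1) by simp
  qed
qed

lemma orth_compl_set_sum:
  assumes "0 \<in> M" "0 \<in> N"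
  shows "orth_compl {x + y | x y. x \<in> M \<and> y \<in> N} = orth_compl M \<inter> orth_compl N" (is "?L = ?R")
proof
  show "?L \<subseteq> ?R"
  proof
    fix z assume z: "z \<in> ?L"
    have sum: "cinner z (m + n) = 0" if "m \<in> M" "n \<in> N" for m n
    proof (rule orth_complD(1)[OF z])
      have "m + n = m + n \<and> m \<in> M \<and> n \<in> N" using that by simp
      then show "m + n \<in> {x + y | x y. x \<in> M \<and> y \<in> N}" by (intro CollectI exI)
    qed
    have "cinner z m = 0" if "m \<in> M" for m
      using sum[OF that assms(2)] by simp
    moreover have "cinner z n = 0" if "n \<in> N" for n
      using sum[OF assms(1) that] by simp
    ultimately have "cinner z m = 0" if "m \<in> M \<union> N" for m
      using that by blast
    then show "z \<in> ?R"
      unfolding orth_compl_def by fast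
  qed
  show "?R \<subseteq> ?L"
  proof
    fix z assume z: "z \<in> ?R"
    have "cinner z (m + n) = 0" if "m \<in> M" "n \<in> N" for m n
      using orth_complD(1)[of z M m] orth_complD(1)[of z N n] z that by (simp add: cinner_add_right)
    then show "z \<in> ?L" unfolding orth_compl_def by fast
  qed
qed

section \<open>Uniform boundedness\<close>

text \<open>Pointwise boundedness covers the complete space by the closed sets \<open>G n\<close>.
  By the Baire category theorem some \<open>G n\<close> contains a ball, and linearity carries the
  bound from that ball to all vectors.\<close>

theorem uniform_boundedness:
  fixes F :: "('a::banach \<Rightarrow> 'b::real_normed_vector) set"
  assumes lin: "\<And>f. f \<in> F \<Longrightarrow> bounded_linear f"
    and pointwise: "\<And>x. bounded ((\<lambda>f. f x) ` F)"
  obtains b where "\<And>f x. f \<in> F \<Longrightarrow> norm (f x) \<le> b * norm x"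
proof -
  define G where "G n = {x. \<forall>f\<in>F. norm (f x) \<le> real n}" for n
  have closed: "closed (G n)" for n
  proof -
    have "G n = (\<Inter>f\<in>F. {x. norm (f x) \<le> real n})" by (auto simp: G_def)
    then show ?thesis
      by (auto intro!: closed_INT closed_Collect_le continuous_intros
          bounded_linear.continuous_on[OF lin])
  qed
  have "x \<in> \<Union> (range G)" for x
  proof -
    obtain a where "\<forall>f\<in>F. norm (f x) \<le> a" using pointwise[of x] unfolding bounded_iff by auto
    moreover obtain n where "a \<le> real n" using real_arch_simple by blast
    ultimately show ?thesis unfolding G_def by (auto intro: order_trans)
  qed
  then have cover: "\<Union> (range G) = UNIV" by blast
  have "\<exists>n. interior (G n) \<noteq> {}"
  proof (rule ccontr)
    assume "\<not> ?thesis"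
    then have "euclidean interior_of \<Union> (range G) = {}"
      using closed by (intro Baire_category_alt disjI1 completely_metrizable_space_euclidean) auto
    then show False unfolding cover by simp
  qed
  then obtain n x0 where "x0 \<in> interior (G n)" by blast
  then obtain r where r: "r > 0" "cball x0 r \<subseteq> G n"
    by (meson mem_interior_cball)
  have "norm (f x) \<le> (2 * real n / r) * norm x" if f: "f \<in> F" for f x
  proof (cases "x = 0")
    case True
    then show ?thesis using linear_0[OF bounded_linear.linear[OF lin[OF f]]] by simp
  next
    case False
    interpret bounded_linear f by (rule lin[OF f])
    \<comment> \<open>Scaling \<open>x\<close> to norm \<open>r\<close> keeps
      \<open>x0 + t *\<^sub>R x\<close> in the closed ball. Then \<open>f (t *\<^sub>R x)\<close> is
      a difference of two values bounded by \<open>n\<close>, whence the constant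
      \<open>2 * real n / r\<close>.\<close>
    define t where "t = r / norm x"
    have t: "t > 0" using r False by (simp add: t_def)
    have "x0 + t *\<^sub>R x \<in> cball x0 r" "x0 \<in> cball x0 r"
      using r False by (auto simp: dist_norm t_def)
    then have "norm (f (x0 + t *\<^sub>R x)) \<le> real n" "norm (f x0) \<le> real n"
      using r f unfolding G_def by blast+
    moreover have "norm (f (t *\<^sub>R x)) \<le> norm (f (x0 + t *\<^sub>R x)) + norm (f x0)"
      using norm_triangle_ineq4[of "f (x0 + t *\<^sub>R x)" "f x0"] by (simp add: add)
    ultimately have "t * norm (f x) \<le> 2 * real n" using t by (simp add: scaleR)
    then show ?thesis using r False by (simp add: t_def field_simps)
  qed
  then show thesis using that by blast
qed

text \<open>Each \<open>y\<close> in \<open>E\<close> is read as the functional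
  \<open>\<lambda>z. cinner z y\<close>; a uniform bound on these functionals, tested at
  \<open>z = y\<close>, bounds \<open>norm y\<close>.\<close>

lemma weakly_bounded_imp_bounded:
  fixes E :: "'a::chilbert_space set"
  assumes "\<And>z. bounded ((\<lambda>y. cinner y z) ` E)"
  shows "bounded E"
proof -
  let ?F = "(\<lambda>y z. cinner z y) ` E"
  have "bounded ((\<lambda>f. f z) ` ?F)" for z
  proof -
    have "cmod (cinner z y) = cmod (cinner y z)" for y
      by (metis cinner_commute complex_mod_cnj)
    then show ?thesis using assms[of z] by (simp add: bounded_iff)
  qed
  moreover have "bounded_linear f" if "f \<in> ?F" for f
    using that bounded_bilinear.bounded_linear_left[OF bounded_bilinear_cinner] by auto
  ultimately obtain b where b: "\<And>f z. f \<in> ?F \<Longrightarrow> cmod (f z) \<le> b * norm z"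
    using uniform_boundedness[of ?F] by blast
  \<comment> \<open>The maximum covers \<open>y = 0\<close>, where dividing by the norm is
    impossible and \<open>b\<close> may be negative.\<close>
  have "norm y \<le> max b 0" if "y \<in> E" for y
  proof -
    have "(norm y)\<^sup>2 \<le> b * norm y"
      using b[of "\<lambda>z. cinner z y" y] that by (simp add: cinner_self norm_power)
    then show ?thesis by (cases "norm y = 0") (auto simp: power2_eq_square)
  qed
  then show ?thesis unfolding bounded_iff by blast
qed

section \<open>Bounded linear relations\<close>

text \<open>A quantitative form of continuity. Only one image of controlled size is requested, since
  images of \<open>x\<close> differ by elements of \<open>mul T\<close>, which may be arbitrarily
  large.\<close>

definition bounded_rel :: "('a::complex_inner \<times> 'a) set \<Rightarrow> bool"
  where "bounded_rel T \<longleftrightarrow> (\<exists>c. \<forall>x\<in>Domain T. \<exists>y. (x, y) \<in> T \<and> norm y \<le> c * norm x)"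

lemma linear_relation_simps:
  assumes "linear_relation T"
  shows linear_relation_zero: "(0, 0) \<in> T"
    and linear_relation_add: "(x, y) \<in> T \<Longrightarrow> (x', y') \<in> T \<Longrightarrow> (x + x', y + y') \<in> T"
    and linear_relation_diff: "(x, y) \<in> T \<Longrightarrow> (x', y') \<in> T \<Longrightarrow> (x - x', y - y') \<in> T"
    and linear_relation_scaleC: "(x, y) \<in> T \<Longrightarrow> (a *\<^sub>C x, a *\<^sub>C y) \<in> T"
    and linear_relation_scaleR: "(x, y) \<in> T \<Longrightarrow> (r *\<^sub>R x, r *\<^sub>R y) \<in> T"
proof -
  show "(0, 0) \<in> T"
    using complex_vector.subspace_0[OF assms] by (simp add: zero_prod_def)
  show "(x, y) \<in> T \<Longrightarrow> (x', y') \<in> T \<Longrightarrow> (x + x', y + y') \<in> T"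
    using complex_vector.subspace_add[OF assms, of "(x, y)" "(x', y')"] by simp
  show "(x, y) \<in> T \<Longrightarrow> (x', y') \<in> T \<Longrightarrow> (x - x', y - y') \<in> T"
    using complex_vector.subspace_diff[OF assms, of "(x, y)" "(x', y')"] by simp
  show "(x, y) \<in> T \<Longrightarrow> (a *\<^sub>C x, a *\<^sub>C y) \<in> T"
    using complex_vector.subspace_scale[OF assms, of "(x, y)" a] by (simp add: scaleC_prod_def)
  show "(x, y) \<in> T \<Longrightarrow> (r *\<^sub>R x, r *\<^sub>R y) \<in> T"
    using csubspace_scaleR[OF assms, of "(x, y)" r] by simp
qed

lemma csubspace_Domain:
  assumes T: "linear_relation T"
  shows "csubspace (Domain T)"
  using linear_relation_zero[OF T] linear_relation_add[OF T] linear_relation_scaleC[OF T]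
  by (intro complex_vector.subspaceI) (blast elim!: DomainE)+

lemma csubspace_mul:
  assumes T: "linear_relation T"
  shows "csubspace (mul T)"
proof (rule complex_vector.subspaceI)
  show "0 \<in> mul T" using linear_relation_zero[OF T] by (simp add: mul_def)
  show "x + y \<in> mul T" if "x \<in> mul T" "y \<in> mul T" for x y
    using linear_relation_add[OF T, of 0 x 0 y] that by (simp add: mul_def)
  show "a *\<^sub>C x \<in> mul T" if "x \<in> mul T" for a x
    using linear_relation_scaleC[OF T, of 0 x a] that by (simp add: mul_def)
qed

lemma diff_mem_mul:
  assumes "linear_relation T" "(x, y) \<in> T" "(x, y') \<in> T"
  shows "y - y' \<in> mul T"
  using linear_relation_diff[OF assms] by (simp add: mul_def)

section \<open>Continuity as boundedness of a linear relation\<close>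

lemma rel_continuous_imp_bounded_rel:
  assumes T: "linear_relation T" and cont: "rel_continuous T"
  shows "bounded_rel T"
proof -
  \<comment> \<open>Continuity at the single pair \<open>(0, 0)\<close>, tested on the unit ball, is
    enough; homogeneity does the rest.\<close>
  have "neighbourhood_in (top_of_set (Range T)) 0 (Range T \<inter> ball 0 1)"
    unfolding neighbourhood_in_def using linear_relation_zero[OF T]
    by (intro conjI exI[of _ "Range T \<inter> ball 0 1"] openin_open_Int) auto
  then have "neighbourhood_in (top_of_set (Domain T)) 0 (T\<inverse> `` (Range T \<inter> ball 0 1))"
    using cont linear_relation_zero[OF T] unfolding rel_continuous_def by blast
  then obtain U where U: "openin (top_of_set (Domain T)) U" "0 \<in> U"
    "U \<subseteq> T\<inverse> `` (Range T \<inter> ball 0 1)"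
    unfolding neighbourhood_in_def by blast
  then obtain e where e: "e > 0" "ball 0 e \<inter> Domain T \<subseteq> U"
    unfolding openin_contains_ball by blast
  have small: "\<exists>y. (x, y) \<in> T \<and> norm y < 1" if "x \<in> Domain T" "norm x < e" for x
  proof -
    have "x \<in> ball 0 e \<inter> Domain T" using that by simp
    then have "x \<in> T\<inverse> `` (Range T \<inter> ball 0 1)" using e(2) U(3) by fast
    then show ?thesis by auto
  qed
  have "\<exists>y. (x, y) \<in> T \<and> norm y \<le> (2 / e) * norm x" if x: "x \<in> Domain T" for x
  proof (cases "x = 0")
    case True
    then show ?thesis using linear_relation_zero[OF T] by (intro exI[of _ 0]) simp
  next
    case False
    \<comment> \<open>The factor 2 puts \<open>t *\<^sub>R x\<close> strictly inside the ball of
      radius \<open>e\<close>; undoing the scaling yields the constant \<open>2 / e\<close>.\<close>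
    define t where "t = e / (2 * norm x)"
    have t: "t > 0" using e False by (simp add: t_def)
    have "norm (t *\<^sub>R x) < e" using e False by (simp add: t_def)
    then obtain y where y: "(t *\<^sub>R x, y) \<in> T" "norm y < 1"
      using small csubspace_scaleR[OF csubspace_Domain[OF T] x] by blast
    have "(x, inverse t *\<^sub>R y) \<in> T"
      using linear_relation_scaleR[OF T y(1), of "inverse t"] t by simp
    moreover have "norm (inverse t *\<^sub>R y) \<le> inverse t * 1"
      using t y(2) by (simp add: mult_left_mono less_imp_le)
    moreover have "inverse t = (2 / e) * norm x" by (simp add: t_def)
    ultimately show ?thesis by (intro exI[of _ "inverse t *\<^sub>R y"]) simp
  qed
  then show ?thesis unfolding bounded_rel_def by blast
qed

text \<open>A bound at the origin moves to any pair \<open>(x, y)\<close> by translation: if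
  \<open>d\<close> is a small image of \<open>x' - x\<close>, then \<open>y + d\<close> is an image
  of \<open>x'\<close> close to \<open>y\<close>.\<close>

lemma bounded_rel_imp_rel_continuous:
  assumes T: "linear_relation T" and bounded: "bounded_rel T"
  shows "rel_continuous T"
  unfolding rel_continuous_def
proof (intro ballI allI impI, clarify)
  fix x y V assume xy: "(x, y) \<in> T" and V: "neighbourhood_in (top_of_set (Range T)) y V"
  obtain c' where c': "\<And>x. x \<in> Domain T \<Longrightarrow> \<exists>y. (x, y) \<in> T \<and> norm y \<le> c' * norm x"
    using bounded unfolding bounded_rel_def by blast
  \<comment> \<open>Enlarging the constant makes it positive, so that the radius
    \<open>e / c\<close> makes sense.\<close>
  define c where "c = max c' 1"
  have c: "\<exists>y. (x, y) \<in> T \<and> norm y \<le> c * norm x" if x: "x \<in> Domain T" for x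
  proof -
    have "c' * norm x \<le> c * norm x" unfolding c_def by (intro mult_right_mono) auto
    then show ?thesis using c'[OF x] order_trans by blast
  qed
  have c_pos: "c > 0" by (simp add: c_def)
  obtain U where U: "openin (top_of_set (Range T)) U" "y \<in> U" "U \<subseteq> V"
    using V unfolding neighbourhood_in_def by blast
  then obtain e where e: "e > 0" "ball y e \<inter> Range T \<subseteq> U"
    unfolding openin_contains_ball by blast
  have "x' \<in> T\<inverse> `` V" if x': "x' \<in> Domain T" "dist x x' < e / c" for x'
  proof -
    have "x' - x \<in> Domain T"
      using x'(1) xy by (intro complex_vector.subspace_diff csubspace_Domain T) auto
    then obtain d where d: "(x' - x, d) \<in> T" "norm d \<le> c * norm (x' - x)"
      using c by blast
    have "(x', y + d) \<in> T"
      using linear_relation_add[OF T xy d(1)] by simp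
    moreover have "c * norm (x' - x) < e"
      using x'(2) c_pos by (simp add: dist_norm norm_minus_commute field_simps)
    then have "y + d \<in> ball y e" using d(2) by (simp add: dist_norm)
    ultimately have "(x', y + d) \<in> T" "y + d \<in> V" using e(2) U(3) by blast+
    then show ?thesis by blast
  qed
  then have "Domain T \<inter> ball x (e / c) \<subseteq> T\<inverse> `` V"
    by (meson IntE mem_ball subsetI)
  moreover have "openin (top_of_set (Domain T)) (Domain T \<inter> ball x (e / c))"
    by (intro openin_open_Int) simp
  moreover have "x \<in> Domain T \<inter> ball x (e / c)"
    using xy e(1) c_pos by auto
  moreover have "T\<inverse> `` V \<subseteq> topspace (top_of_set (Domain T))" by auto
  ultimately show "neighbourhood_in (top_of_set (Domain T)) x (T\<inverse> `` V)"
    unfolding neighbourhood_in_def by blast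
qed

section \<open>The domain of the adjoint\<close>

lemma Domain_rel_adjoint_subset: "Domain (rel_adjoint T) \<subseteq> orth_compl (mul T)"
proof
  fix x assume "x \<in> Domain (rel_adjoint T)"
  then obtain w where w: "\<And>f g. (f, g) \<in> T \<Longrightarrow> cinner g x = cinner f w"
    unfolding rel_adjoint_def by blast
  have "cinner x y = 0" if "y \<in> mul T" for y
    using w[of 0 y] that by (simp add: mul_def cinner_simps cinner_eq_0_commute[of x])
  then show "x \<in> orth_compl (mul T)" by (simp add: orth_compl_def)
qed

text \<open>For \<open>z\<close> orthogonal to \<open>mul T\<close>, pairing the images of
  \<open>x\<close> with \<open>z\<close> gives a bounded linear functional on
  \<open>Domain T\<close>. Its Riesz vector \<open>w\<close> satisfies
  \<open>(z, w) \<in> rel_adjoint T\<close>.\<close>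

lemma bounded_rel_imp_Domain_rel_adjoint:
  fixes T :: "('a::chilbert_space \<times> 'a) set"
  assumes T: "linear_relation T" and bounded: "bounded_rel T"
  shows "Domain (rel_adjoint T) = orth_compl (mul T)"
proof (intro antisym Domain_rel_adjoint_subset subsetI)
  fix z assume z: "z \<in> orth_compl (mul T)"
  obtain c where c: "\<And>x. x \<in> Domain T \<Longrightarrow> \<exists>y. (x, y) \<in> T \<and> norm y \<le> c * norm x"
    using bounded unfolding bounded_rel_def by blast
  \<comment> \<open>The choice of image is immaterial: two images of \<open>x\<close> differ by an
    element of \<open>mul T\<close>, to which \<open>z\<close> is orthogonal.\<close>
  define \<phi> where "\<phi> x = cinner (SOME y. (x, y) \<in> T) z" for x
  have \<phi>: "\<phi> x = cinner y z" if xy: "(x, y) \<in> T" for x y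
  proof -
    have "(x, SOME y. (x, y) \<in> T) \<in> T" using xy by (rule someI)
    then have "(SOME y. (x, y) \<in> T) - y \<in> mul T" using diff_mem_mul[OF T] xy by blast
    then have "cinner ((SOME y. (x, y) \<in> T) - y) z = 0" by (rule orth_complD(2)[OF z])
    then show ?thesis by (simp add: \<phi>_def cinner_simps)
  qed
  obtain w where w: "\<And>x. x \<in> Domain T \<Longrightarrow> \<phi> x = cinner x w"
  proof (rule riesz_representation[of "Domain T" \<phi> "c * norm z"])
    show "csubspace (Domain T)" by (rule csubspace_Domain[OF T])
    show "\<phi> (x + x') = \<phi> x + \<phi> x'" if dom: "x \<in> Domain T" "x' \<in> Domain T" for x x'
    proof -
      obtain y y' where "(x, y) \<in> T" "(x', y') \<in> T" using dom by blast
      then show ?thesis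
        by (simp add: \<phi>[of x y] \<phi>[of x' y'] \<phi>[of "x + x'" "y + y'"] linear_relation_add[OF T]
            cinner_add_left)
    qed
    show "\<phi> (a *\<^sub>C x) = a * \<phi> x" if dom: "x \<in> Domain T" for a x
    proof -
      obtain y where "(x, y) \<in> T" using dom by blast
      then show ?thesis
        by (simp add: \<phi>[of x y] \<phi>[of "a *\<^sub>C x" "a *\<^sub>C y"] linear_relation_scaleC[OF T]
            cinner_scaleC_left)
    qed
    show "cmod (\<phi> x) \<le> c * norm z * norm x" if dom: "x \<in> Domain T" for x
    proof -
      obtain y where y: "(x, y) \<in> T" "norm y \<le> c * norm x" using c[OF dom] by blast
      have "cmod (\<phi> x) \<le> norm y * norm z" unfolding \<phi>[OF y(1)] by (rule norm_cinner_le)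
      also have "\<dots> \<le> c * norm x * norm z" by (intro mult_right_mono y(2)) simp
      finally show ?thesis by (simp add: mult_ac)
    qed
  qed blast
  have "cinner y z = cinner x w" if "(x, y) \<in> T" for x y
    using \<phi>[OF that] w[OF DomainI[OF that]] by simp
  then have "(z, w) \<in> rel_adjoint T"
    unfolding rel_adjoint_def by blast
  then show "z \<in> Domain (rel_adjoint T)" by blast
qed

text \<open>Subtracting from an image its projection onto \<open>mul T\<close> leaves an image,
  because closedness puts the projection in \<open>mul T\<close> itself.\<close>

lemma orth_mul_representative:
  fixes T :: "('a::chilbert_space \<times> 'a) set"
  assumes T: "linear_relation T" and closed: "closed (mul T)" and x: "x \<in> Domain T"
  obtains y where "(x, y) \<in> T" "y \<in> orth_compl (mul T)"
proof -
  obtain y where y: "(x, y) \<in> T" using x by blast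
  obtain p where p: "p \<in> closure (mul T)" "y - p \<in> orth_compl (mul T)"
    using orthogonal_projection_exists[OF csubspace_mul[OF T]] by blast
  have "(0, p) \<in> T" using p(1) closed by (simp add: mul_def)
  then have "(x, y - p) \<in> T" using linear_relation_diff[OF T y] by force
  then show thesis using that p(2) by blast
qed

text \<open>Each vector of the adjoint's domain bounds, by duality, one coefficient of the images of
  unit vectors, so uniform boundedness applies to the images orthogonal to the multivalued part.\<close>

lemma Domain_rel_adjoint_imp_bounded_rel:
  fixes T :: "('a::chilbert_space \<times> 'a) set"
  assumes T: "linear_relation T" and closed: "closed (mul T)"
    and dom: "orth_compl (mul T) \<subseteq> Domain (rel_adjoint T)"
  shows "bounded_rel T"
proof -
  define E where "E = {y. \<exists>x. (x, y) \<in> T \<and> y \<in> orth_compl (mul T) \<and> norm x \<le> 1}"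
  have "bounded ((\<lambda>y. cinner y z) ` E)" for z
  proof -
    \<comment> \<open>Split \<open>z\<close> along \<open>mul T\<close>: the component
      \<open>p\<close> is orthogonal to every \<open>y\<close> in \<open>E\<close>, and the
      remainder lies in the domain of the adjoint.\<close>
    obtain p where p: "p \<in> closure (mul T)" "z - p \<in> orth_compl (mul T)"
      using orthogonal_projection_exists[OF csubspace_mul[OF T]] by blast
    then obtain w where w: "\<And>f g. (f, g) \<in> T \<Longrightarrow> cinner g (z - p) = cinner f w"
      using dom unfolding rel_adjoint_def by blast
    have "cmod (cinner y z) \<le> norm w" if y: "y \<in> E" for y
    proof -
      obtain x where x: "(x, y) \<in> T" "y \<in> orth_compl (mul T)" "norm x \<le> 1"
        using y unfolding E_def by blast
      have "cinner y p = 0" using orth_complD(1)[OF x(2)] p(1) closed by simp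
      then have "cinner y z = cinner x w" using w[OF x(1)] by (simp add: cinner_simps)
      also have "cmod \<dots> \<le> norm x * norm w" by (rule norm_cinner_le)
      also have "\<dots> \<le> norm w" using x(3) by (simp add: mult_left_le_one_le)
      finally show ?thesis .
    qed
    then show ?thesis unfolding bounded_iff by blast
  qed
  then have "bounded E" by (rule weakly_bounded_imp_bounded)
  then obtain b where b: "\<And>y. y \<in> E \<Longrightarrow> norm y \<le> b" unfolding bounded_iff by blast
  have "\<exists>y. (x, y) \<in> T \<and> norm y \<le> b * norm x" if x: "x \<in> Domain T" for x
  proof (cases "x = 0")
    case True
    then show ?thesis using linear_relation_zero[OF T] by (intro exI[of _ 0]) simp
  next
    case False
    obtain y where y: "(x, y) \<in> T" "y \<in> orth_compl (mul T)"
      using orth_mul_representative[OF T closed x] by blast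
    have "inverse (norm x) *\<^sub>R y \<in> E"
      unfolding E_def using False linear_relation_scaleR[OF T y(1)]
        csubspace_scaleR[OF csubspace_orth_compl y(2)]
      by (intro CollectI exI[of _ "inverse (norm x) *\<^sub>R x"]) simp
    then have "norm y \<le> b * norm x" using b[of "inverse (norm x) *\<^sub>R y"] False
      by (simp add: field_simps)
    then show ?thesis using y(1) by blast
  qed
  then show ?thesis unfolding bounded_rel_def by blast
qed

section \<open>Decomposability and the operator part\<close>

lemma bounded_rel_imp_decomposable:
  fixes T :: "('a::chilbert_space \<times> 'a) set"
  assumes T: "linear_relation T" and closed: "closed (mul T)" and bounded: "bounded_rel T"
  shows "decomposable T" "bounded_operator (op_part T)"
proof -
  \<comment> \<open>The adjoint's domain is an orthogonal complement, hence already closed, and the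
    condition on first entries holds for every pair of \<open>T\<close>.\<close>
  have op_part: "op_part T = T \<inter> (UNIV \<times> orth_compl (mul T))"
    unfolding op_part_def bounded_rel_imp_Domain_rel_adjoint[OF T bounded]
      closure_closed[OF closed_orth_compl]
    using closure_subset[of "Domain T"] by auto
  show "decomposable T"
    unfolding decomposable_def op_part using orth_mul_representative[OF T closed] by blast
  have "single_valued (op_part T)"
  proof (rule single_valuedI)
    fix x y y' assume "(x, y) \<in> op_part T" "(x, y') \<in> op_part T"
    then have "y - y' \<in> mul T" "y - y' \<in> orth_compl (mul T)"
      using diff_mem_mul[OF T] complex_vector.subspace_diff[OF csubspace_orth_compl]
      unfolding op_part by blast+
    then show "y = y'" using orth_compl_Int by fastforce
  qed
  moreover obtain c where c: "\<And>x. x \<in> Domain T \<Longrightarrow> \<exists>y. (x, y) \<in> T \<and> norm y \<le> c * norm x"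
    using bounded unfolding bounded_rel_def by blast
  \<comment> \<open>By Pythagoras the image orthogonal to \<open>mul T\<close> has the least norm
    among all images of \<open>x\<close>, so it inherits the bound of \<open>y'\<close>.\<close>
  have "norm y \<le> c * norm x" if xy: "(x, y) \<in> op_part T" for x y
  proof -
    obtain y' where y': "(x, y') \<in> T" "norm y' \<le> c * norm x"
      using c[of x] xy unfolding op_part by blast
    have "y' - y \<in> mul T" using diff_mem_mul[OF T y'(1)] xy unfolding op_part by blast
    then have "Re (cinner y (y' - y)) = 0"
      using xy orth_complD(1)[of y "mul T"] unfolding op_part by simp
    then have "(norm y')\<^sup>2 = (norm y)\<^sup>2 + (norm (y' - y))\<^sup>2"
      using norm_add_sq[of y "y' - y"] by simp
    then have "(norm y)\<^sup>2 \<le> (norm y')\<^sup>2" by simp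
    then have "norm y \<le> norm y'" by (rule power2_le_imp_le) simp
    then show ?thesis using y'(2) by simp
  qed
  ultimately show "bounded_operator (op_part T)" unfolding bounded_operator_def by blast
qed

lemma decomposable_imp_bounded_rel:
  assumes "decomposable T" "bounded_operator (op_part T)"
  shows "bounded_rel T"
proof -
  obtain c where c: "\<And>x y. (x, y) \<in> op_part T \<Longrightarrow> norm y \<le> c * norm x"
    using assms(2) unfolding bounded_operator_def by blast
  have "\<exists>y. (x, y) \<in> T \<and> norm y \<le> c * norm x" if x: "x \<in> Domain T" for x
  proof -
    obtain y where "(x, y) \<in> op_part T"
      using x assms(1) unfolding decomposable_def by blast
    then show ?thesis using c unfolding op_part_def by blast
  qed
  then show ?thesis unfolding bounded_rel_def by blast
qed

section \<open>The relation \<open>proj_rel M N\<close>\<close>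

lemma Domain_rel_adjoint_proj_rel:
  assumes M: "csubspace M" and N: "csubspace N"
  shows "Domain (rel_adjoint (proj_rel M N)) = {x + y | x y. x \<in> orth_compl M \<and> y \<in> orth_compl N}"
    (is "_ = ?S")
proof
  show "Domain (rel_adjoint (proj_rel M N)) \<subseteq> ?S"
  proof
    fix z assume "z \<in> Domain (rel_adjoint (proj_rel M N))"
    then obtain w where zw: "(z, w) \<in> rel_adjoint (proj_rel M N)" by blast
    have w: "cinner m z = cinner (m + n) w" if "m \<in> M" "n \<in> N" for m n
    proof -
      have "(m + n, m) \<in> proj_rel M N" using that unfolding proj_rel_def by blast
      then show ?thesis using zw unfolding rel_adjoint_def by blast
    qed
    \<comment> \<open>The adjoint condition separates: \<open>n = 0\<close> gives
      \<open>z - w\<close> orthogonal to \<open>M\<close>, and \<open>m = 0\<close> below gives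
      \<open>w\<close> orthogonal to \<open>N\<close>.\<close>
    have "cinner m (z - w) = 0" if "m \<in> M" for m
      using w[OF that complex_vector.subspace_0[OF N]] by (simp add: cinner_simps)
    then have "z - w \<in> orth_compl M"
      by (simp add: orth_compl_def cinner_eq_0_commute[of "z - w"])
    moreover have "cinner n w = 0" if "n \<in> N" for n
      using w[OF complex_vector.subspace_0[OF M] that] by (simp add: cinner_simps)
    then have "w \<in> orth_compl N"
      by (simp add: orth_compl_def cinner_eq_0_commute[of w])
    ultimately have "z = (z - w) + w \<and> z - w \<in> orth_compl M \<and> w \<in> orth_compl N" by simp
    then show "z \<in> ?S" by (intro CollectI exI)
  qed
  show "?S \<subseteq> Domain (rel_adjoint (proj_rel M N))"
  proof
    fix z assume "z \<in> ?S"
    then obtain u v where z: "z = u + v" and u: "u \<in> orth_compl M" and v: "v \<in> orth_compl N"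
      by blast
    have "cinner m z = cinner (m + n) v" if "m \<in> M" "n \<in> N" for m n
      using orth_complD(2)[OF u that(1)] orth_complD(2)[OF v that(2)] by (simp add: z cinner_simps)
    then have "(z, v) \<in> rel_adjoint (proj_rel M N)"
      unfolding rel_adjoint_def proj_rel_def by auto
    then show "z \<in> Domain (rel_adjoint (proj_rel M N))" by blast
  qed
qed

theorem proposition4p8:
  fixes M N :: "'a::chilbert_space set"
  assumes "separable_space (euclidean :: 'a topology)"
    and "csubspace M" and "csubspace N"
    and "closed (M \<inter> N)"
  shows "(rel_continuous (proj_rel M N) \<longleftrightarrow>
            decomposable (proj_rel M N) \<and> bounded_operator (op_part (proj_rel M N)))
       \<and> (decomposable (proj_rel M N) \<and> bounded_operator (op_part (proj_rel M N)) \<longleftrightarrow>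
            closure M \<inter> closure N = M \<inter> N \<and>
            closed {x + y | x y. x \<in> orth_compl M \<and> y \<in> orth_compl N})"
proof -
  let ?T = "proj_rel M N"
  let ?S = "{x + y | x y. x \<in> orth_compl M \<and> y \<in> orth_compl N}"
  let ?K = "M \<inter> N"
  note T = linear_relation_proj_rel[OF assms(2,3)]
  note mul = mul_proj_rel[OF assms(2,3)]
  note dom = Domain_rel_adjoint_proj_rel[OF assms(2,3)]
  have closed: "closed (mul ?T)" using mul assms(4) by simp
  have S: "csubspace ?S"
    by (rule complex_vector.subspace_sums[OF csubspace_orth_compl csubspace_orth_compl])
  \<comment> \<open>The complement of a sum is the intersection of the complements, here the double
    complements of \<open>M\<close> and \<open>N\<close>, which are their closures.\<close>
  have S_perp: "orth_compl ?S = closure M \<inter> closure N"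
    unfolding orth_compl_orth_compl[OF assms(2), symmetric] orth_compl_orth_compl[OF assms(3), symmetric]
    by (intro orth_compl_set_sum complex_vector.subspace_0 csubspace_orth_compl)
  have K: "csubspace ?K" using csubspace_mul[OF T] mul by simp
  have continuous: "rel_continuous ?T \<longleftrightarrow> bounded_rel ?T"
    using rel_continuous_imp_bounded_rel[OF T] bounded_rel_imp_rel_continuous[OF T] by blast
  have decomposable: "decomposable ?T \<and> bounded_operator (op_part ?T) \<longleftrightarrow> bounded_rel ?T"
    using decomposable_imp_bounded_rel bounded_rel_imp_decomposable[OF T closed] by blast
  have "bounded_rel ?T \<longleftrightarrow> ?S = orth_compl ?K"
  proof
    assume "bounded_rel ?T"
    from bounded_rel_imp_Domain_rel_adjoint[OF T this] show "?S = orth_compl ?K"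
      unfolding dom mul .
  next
    assume "?S = orth_compl ?K"
    then have "orth_compl (mul ?T) \<subseteq> Domain (rel_adjoint ?T)" unfolding dom mul by simp
    then show "bounded_rel ?T" by (rule Domain_rel_adjoint_imp_bounded_rel[OF T closed])
  qed
  also have "\<dots> \<longleftrightarrow> closure M \<inter> closure N = ?K \<and> closed ?S"
  proof
    assume *: "?S = orth_compl ?K"
    \<comment> \<open>Taking complements again returns \<open>?K\<close> because it is a closed
      subspace; \<open>S_perp\<close> then identifies it with the intersection of the
      closures.\<close>
    have "orth_compl ?S = ?K"
      unfolding * orth_compl_orth_compl[OF K] by (rule closure_closed[OF assms(4)])
    moreover have "closed ?S" unfolding * by (rule closed_orth_compl)
    ultimately show "closure M \<inter> closure N = ?K \<and> closed ?S" using S_perp by simp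
  next
    assume *: "closure M \<inter> closure N = ?K \<and> closed ?S"
    \<comment> \<open>Closedness of the sum enters here: a closed subspace is determined by its
      complement.\<close>
    then have "?S = orth_compl (orth_compl ?S)"
      unfolding orth_compl_orth_compl[OF S] by simp
    then show "?S = orth_compl ?K" using S_perp * by simp
  qed
  finally show ?thesis using continuous decomposable by blast
qed

end
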